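(* Let $c=5/4$, $\alpha>2$, $\lambda_b>0$, $P>0$, $\sigma_k^2\ge0$, $\omega>0$ be constants. Let $d_1,d_2$ be independent with density $f_d(x)=2c\lambda_b\pi x e^{-c\lambda_b\pi x^2}$, $x\ge0$, and let $d=\min\{d_1,d_2\}$. For $w\in\mathbb C$ with $\mathrm{Re}(w)>0$ (in the paper $w=s+t$ with $\mathrm{Re}(s),\mathrm{Re}(t)>0$) define $$\varphi(w)=\mathbb{E}\left\{\exp\left(-\frac{\sigma_k^2}{P}\,w\,d^{\alpha}-\pi\lambda_b\,\omega\, d^2 w^{2/\alpha}\right)\right\}.$$ Then $$\varphi(w)=\frac{2c}{2c+\omega w^{2/\alpha}}\,H_{1,1}^{1,1}\left(\frac{\sigma_k^2}{P}\,w\left(\pi\lambda_b\left(2c+\omega w^{2/\alpha}\right)\right)^{-\alpha/2}\right),$$ where $H_{1,1}^{1,1}(x)$ denotes $H_{1,1}^{1,1}\left(x\,\middle|\,\begin{smallmatrix}(0,\alpha/2)\\(0,1)\end{smallmatrix}\right)$. Moreover, for fixed $w$, as $\sigma_k^2/P\to0$, $\varphi(w)\to\frac{2c}{2c+\omega w^{2/\alpha}}$.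
   Context: Model: base stations form a homogeneous PPP of intensity $\lambda_b$; user-to-serving-BS distance has density $f_d$. Under random NOMA grouping, the near user's distance is the smaller of two i.i.d. distances. $\sigma_k^2=\sigma^2\|\mathbf u_k\|^2$ is filtered noise power, $P$ the transmit power per stream, $\omega>0$ a fixed interference-related constant (in the paper $\Gamma(1-2/\alpha)(\frac{\rho_I}{P}|\mathbf u_k^{\mathrm H}\mathbf 1|^2)^{2/\alpha}$). Principal branches for complex powers. Fox H-function: $H_{1,1}^{1,1}\left(x\,\middle|\,\begin{smallmatrix}(0,\alpha/2)\\(0,1)\end{smallmatrix}\right)=\frac{1}{2\pi \mathrm{i}}\int_{\mathcal L}\Gamma(\xi)\Gamma(1-\tfrac{\alpha}{2}\xi)x^{-\xi}d\xi$, with $\mathcal L$ a vertical line $\mathrm{Re}(\xi)=\gamma$, $0<\gamma<2/\alpha$.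
   Formalization: The H-function identity is stated only for σ_k² > 0, since at σ_k² = 0 the argument of H is 0 and the defining contour integral with x^{-ξ} is undefined; the limit σ_k²/P → 0 is taken as σ_k² → 0+ with P fixed. *)

theory Defs
  imports "HOL-Probability.Probability"
begin

definition dist_density :: "real \<Rightarrow> real \<Rightarrow> real \<Rightarrow> real" where
  "dist_density c lb x = (if 0 \<le> x then 2 * c * lb * pi * x * exp (- c * lb * pi * x\<^sup>2) else 0)"

definition dist_measure :: "real \<Rightarrow> real \<Rightarrow> real measure" where
  "dist_measure c lb = density lborel (\<lambda>x. ennreal (dist_density c lb x))"

definition phi :: "real \<Rightarrow> real \<Rightarrow> real \<Rightarrow> real \<Rightarrow> real \<Rightarrow> real \<Rightarrow> complex \<Rightarrow> complex" where
  "phi c alpha lb s2 P omega w =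
     (\<integral>z. (let d = min (fst z) (snd z) in
             exp (- complex_of_real (s2 / P) * w * complex_of_real (d powr alpha)
                  - complex_of_real (pi * lb * omega * d\<^sup>2) * w powr (2 / alpha)))
       \<partial>(dist_measure c lb \<Otimes>\<^sub>M dist_measure c lb))"

text \<open>Fox H-function H^{1,1}_{1,1}(x | (0,alpha/2); (0,1)) as a contour integral over the
  vertical line Re xi = gamma (0 < gamma < 2/alpha), parametrised xi = gamma + i t,
  d xi = i dt, so (1/(2 pi i)) \<integral> ... d xi = (1/(2 pi)) \<integral> ... dt. Principal branch for x^(-xi).\<close>
definition foxH :: "real \<Rightarrow> real \<Rightarrow> complex \<Rightarrow> complex" where
  "foxH alpha gamma x =
     (\<integral>t. (let \<xi> = Complex gamma t in
            Gamma \<xi> * Gamma (1 - complex_of_real (alpha / 2) * \<xi>) * x powr (- \<xi>)) \<partial>lborel)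
     / complex_of_real (2 * pi)"

end

(* With u = d^2 exponentially distributed of rate 2 c \<pi> lb, phi(w) is a multiple of the Laplace-type integral
   of exp (- A u - W u^(alpha/2)), where A = \<pi> lb (2 c + omega w^(2/alpha)) and W = (s2 / P) w. Inserting the Mellin
   inversion formula for exp (- W u^(alpha/2)) and exchanging integrals, the inner integral becomes the Gamma
   integral with complex scale A, which yields the Mellin-Barnes integral of the H-function.

   The complex-scale Gamma integral needs no contour rotation: expand around a large real scale r with |z - r| < r
   and use the binomial series. Applied to z = cis \<theta>, it also gives the exponential decay of Gamma on vertical
   lines. Mellin inversion is then Fourier inversion at 0 by Gaussian regularisation.
   All integrals over (0, \<infinity>) are transported to the real line by u = exp s. *)
theory Submission
  imports Defs
begin

subsection \<open>The Gamma integral with complex scale\<close>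

text \<open>The substitution u = exp s has Jacobian exp s. The change of variables theorem speaks of
  the completed Lebesgue measure; Borel measurability of \<open>f\<close> brings the result down to
  \<open>lborel\<close>.\<close>

lemma has_bochner_integral_exp_substitution:
  fixes f :: "real \<Rightarrow> complex"
  assumes "f absolutely_integrable_on {0<..}"
    and [measurable]: "f \<in> borel_measurable borel"
  shows "has_bochner_integral lborel (\<lambda>s. exp s *\<^sub>R f (exp s)) (integral {0<..} f)"
proof -
  have rng: "(exp :: real \<Rightarrow> real) ` UNIV = {0<..}"
    by (auto simp: image_iff) (metis exp_ln)
  have *: "(\<lambda>s. \<bar>exp s\<bar> *\<^sub>R f (exp s)) absolutely_integrable_on UNIV \<and>
      integral UNIV (\<lambda>s. \<bar>exp s\<bar> *\<^sub>R f (exp s)) = integral {0<..} f"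
    using has_absolute_integral_change_of_variables_real[of UNIV exp exp f "integral {0<..} f"] assms
    by (auto simp: rng intro!: derivative_eq_intros inj_onI)
  have int: "integrable lborel (\<lambda>s. exp s *\<^sub>R f (exp s))"
  proof -
    have "integrable (completion lborel) (\<lambda>s. exp s *\<^sub>R f (exp s))"
      using * by (simp add: set_integrable_def)
    then show ?thesis
      by (subst (asm) integrable_completion) auto
  qed
  then show ?thesis
    using * integral_lborel[OF int] by (simp add: has_bochner_integral_iff)
qed

lemma has_bochner_integral_Gamma_exp:
  assumes "Re \<xi> > 0"
  shows "has_bochner_integral lborel (\<lambda>s. exp (\<xi> * of_real s - of_real (exp s))) (Gamma \<xi>)"
proof -
  \<comment> \<open>Writing the power through \<open>ln\<close> gives a function that is Borel on
    the whole line and agrees with the Euler integrand on (0, infinity).\<close>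
  define f where "f = (\<lambda>t::real. exp ((\<xi> - 1) * of_real (ln t)) / complex_of_real (exp t))"
  have eq: "of_real t powr (\<xi> - 1) / of_real (exp t) = f t" if "t \<in> {0<..}" for t
    using that by (simp add: f_def powr_def Ln_of_real)
  have "f absolutely_integrable_on {0<..}"
    using absolutely_integrable_Gamma_integral'[OF assms] eq
    by (subst set_integrable_cong[OF refl refl eq[symmetric]]) auto
  moreover have "integral {0<..} f = Gamma \<xi>"
    using has_integral_eq[OF eq Gamma_integral_complex'[OF assms]] by (simp add: integral_unique)
  moreover have "f \<in> borel_measurable borel"
    unfolding f_def by measurable
  ultimately have "has_bochner_integral lborel (\<lambda>s. exp s *\<^sub>R f (exp s)) (Gamma \<xi>)"
    using has_bochner_integral_exp_substitution[of f] by simp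
  also have "(\<lambda>s. exp s *\<^sub>R f (exp s)) = (\<lambda>s. exp (\<xi> * of_real s - of_real (exp s)))"
    by (simp add: f_def fun_eq_iff scaleR_conv_of_real exp_of_real[symmetric] exp_diff exp_add algebra_simps
        flip: exp_minus)
  finally show ?thesis .
qed

text \<open>Shifting s by ln r multiplies exp s by r. As r is positive, Ln (r z) = ln r + Ln z, so
  the principal powers multiply without a branch correction.\<close>

lemma has_bochner_integral_Gamma_exp_scale:
  fixes \<xi> z C :: complex and r :: real
  assumes int: "has_bochner_integral lborel (\<lambda>s. exp (\<xi> * of_real s - z * of_real (exp s))) (C * z powr (-\<xi>))"
    and r: "r > 0" and z: "z \<noteq> 0"
  shows "has_bochner_integral lborel (\<lambda>s. exp (\<xi> * of_real s - (of_real r * z) * of_real (exp s)))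
           (C * (of_real r * z) powr (-\<xi>))"
proof -
  have "has_bochner_integral lborel (\<lambda>s. exp (\<xi> * of_real (ln r + 1 * s) - z * of_real (exp (ln r + 1 * s))))
          (C * z powr (-\<xi>) /\<^sub>R \<bar>1\<bar>)"
    using int by (subst (asm) lborel_has_bochner_integral_real_affine_iff[of 1 _ _ "ln r"]) auto
  then have "has_bochner_integral lborel (\<lambda>s. exp (- \<xi> * of_real (ln r)) *
      exp (\<xi> * of_real (ln r + s) - z * of_real (exp (ln r + s))))
          (exp (- \<xi> * of_real (ln r)) * (C * z powr (-\<xi>)))"
    by (intro has_bochner_integral_mult_right) auto
  also have "(\<lambda>s. exp (- \<xi> * of_real (ln r)) *
      exp (\<xi> * of_real (ln r + s) - z * of_real (exp (ln r + s)))) =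
      (\<lambda>s. exp (\<xi> * of_real s - (of_real r * z) * of_real (exp s)))"
    using r by (simp add: fun_eq_iff mult_exp_exp exp_add[of _ "ln r"] exp_add[of "ln r"] algebra_simps)
  also have "exp (- \<xi> * of_real (ln r)) * (C * z powr (-\<xi>)) = C * (of_real r * z) powr (-\<xi>)"
    using r z by (simp add: powr_def Ln_times_of_real[OF r z] Ln_of_real[OF r] mult_exp_exp ring_distribs)
  finally show ?thesis .
qed

text \<open>Splitting exp (-z e^s) as exp (-e^s) exp ((1 - z) e^s) and expanding the second factor
  produces the values Gamma (\<xi> + k) = pochhammer \<xi> k * Gamma \<xi>, which assemble into the
  binomial series of (1 + (z - 1))^(-\<xi>).\<close>

lemma has_bochner_integral_Gamma_exp_near_1:
  assumes \<xi>: "Re \<xi> > 0" and z: "norm (1 - z) < 1"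
  shows "has_bochner_integral lborel (\<lambda>s. exp (\<xi> * of_real s - z * of_real (exp s)))
           (Gamma \<xi> * z powr (-\<xi>))"
proof -
  define \<rho> where "\<rho> = norm (1 - z)"
  define f where "f = (\<lambda>n s. \<Sum>k<n. exp (\<xi> * of_real s - of_real (exp s)) *
                         (((1 - z) * of_real (exp s)) ^ k /\<^sub>R fact k))"
  \<comment> \<open>The partial sums of the exponential series are at most exp (\<rho> e^s) in
    modulus, and \<rho> < 1 leaves the decay rate 1 - \<rho> in the dominating function.\<close>
  define D where "D = (\<lambda>s::real. exp (Re \<xi> * s - (1 - \<rho>) * exp s))"
  have nz: "\<xi> \<notin> \<int>\<^sub>\<le>\<^sub>0" using \<xi> by (auto elim!: nonpos_Ints_cases)
  \<comment> \<open>Integrability of \<open>D\<close> comes from the Euler integral with real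
    exponent Re \<xi> and real scale 1 - \<rho>.\<close>
  have "has_bochner_integral lborel (\<lambda>s. exp (of_real (Re \<xi>) * complex_of_real s - (of_real (1 - \<rho>) * 1) * of_real (exp s)))
           (Gamma (of_real (Re \<xi>)) * (of_real (1 - \<rho>) * 1) powr (-of_real (Re \<xi>)))"
    using has_bochner_integral_Gamma_exp[of "of_real (Re \<xi>)"] \<xi> z
    by (intro has_bochner_integral_Gamma_exp_scale) (auto simp: \<rho>_def)
  then have "integrable lborel (\<lambda>s. norm (exp (of_real (Re \<xi>) * complex_of_real s - (of_real (1 - \<rho>) * 1) * of_real (exp s))))"
    by (intro integrable_norm) (auto simp: has_bochner_integral_iff)
  then have D: "integrable lborel D" by (simp add: D_def norm_exp_eq_Re)
  have trm: "has_bochner_integral lborel (\<lambda>s. exp (\<xi> * of_real s - of_real (exp s)) *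
        (((1 - z) * of_real (exp s)) ^ k /\<^sub>R fact k)) (Gamma \<xi> * ((-\<xi> gchoose k) * (z - 1) ^ k))" for k
  proof -
    have "has_bochner_integral lborel (\<lambda>s. (1 - z) ^ k / fact k * exp ((\<xi> + of_nat k) * of_real s - of_real (exp s)))
       ((1 - z) ^ k / fact k * Gamma (\<xi> + of_nat k))"
      using \<xi> by (intro has_bochner_integral_mult_right has_bochner_integral_Gamma_exp) auto
    also have "(\<lambda>s. (1 - z) ^ k / fact k * exp ((\<xi> + of_nat k) * of_real s - of_real (exp s))) =
       (\<lambda>s. exp (\<xi> * of_real s - of_real (exp s)) * (((1 - z) * of_real (exp s)) ^ k /\<^sub>R fact k))"
    proof
      fix s :: real
      have "exp ((\<xi> + of_nat k) * of_real s - of_real (exp s)) =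
          exp (\<xi> * of_real s - of_real (exp s)) * exp (of_nat k * of_real s)"
        by (simp add: mult_exp_exp algebra_simps)
      also have "exp (of_nat k * of_real s) = complex_of_real (exp s) ^ k"
        by (simp add: exp_of_nat_mult exp_of_real)
      finally show "(1 - z) ^ k / fact k * exp ((\<xi> + of_nat k) * of_real s - of_real (exp s)) =
          exp (\<xi> * of_real s - of_real (exp s)) * (((1 - z) * of_real (exp s)) ^ k /\<^sub>R fact k)"
        by (simp add: power_mult_distrib scaleR_conv_of_real divide_inverse mult_ac)
    qed
    also have "Gamma (\<xi> + of_nat k) = pochhammer \<xi> k * Gamma \<xi>"
      using pochhammer_Gamma[OF nz, of k] nz by (simp add: Gamma_eq_zero_iff)
    also have "(1 - z) ^ k / fact k * (pochhammer \<xi> k * Gamma \<xi>) = Gamma \<xi> * ((-\<xi> gchoose k) * (z - 1) ^ k)"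
      by (simp add: gbinomial_pochhammer power_mult_distrib[symmetric] field_simps)
    finally show ?thesis .
  qed
  have f: "has_bochner_integral lborel (f n) (\<Sum>k<n. Gamma \<xi> * ((-\<xi> gchoose k) * (z - 1) ^ k))" for n
    unfolding f_def by (intro has_bochner_integral_sum trm)
  have lim1: "(\<lambda>n. integral\<^sup>L lborel (f n)) \<longlonglongrightarrow> Gamma \<xi> * z powr (-\<xi>)"
  proof -
    have "(\<lambda>n. Gamma \<xi> * ((-\<xi> gchoose n) * (z - 1) ^ n)) sums (Gamma \<xi> * (1 + (z - 1)) powr (-\<xi>))"
      using z by (intro sums_mult gen_binomial_complex) (simp add: norm_minus_commute)
    then show ?thesis using f by (simp add: sums_def has_bochner_integral_iff)
  qed
  have lim: "AE s in lborel. (\<lambda>n. f n s) \<longlonglongrightarrow> exp (\<xi> * of_real s - z * of_real (exp s))"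
  proof (intro AE_I2)
    fix s :: real
    have "(\<lambda>k. exp (\<xi> * of_real s - of_real (exp s)) * (((1 - z) * of_real (exp s)) ^ k /\<^sub>R fact k)) sums
       (exp (\<xi> * of_real s - of_real (exp s)) * exp ((1 - z) * of_real (exp s)))"
      by (intro sums_mult exp_converges)
    then show "(\<lambda>n. f n s) \<longlonglongrightarrow> exp (\<xi> * of_real s - z * of_real (exp s))"
      by (simp add: sums_def f_def mult_exp_exp algebra_simps)
  qed
  have bound: "AE s in lborel. norm (f n s) \<le> D s" for n
  proof (intro AE_I2)
    fix s :: real
    have "norm (\<Sum>k<n. ((1 - z) * of_real (exp s)) ^ k /\<^sub>R fact k) \<le> (\<Sum>k<n. (\<rho> * exp s) ^ k /\<^sub>R fact k)"
      by (intro sum_norm_le) (simp add: norm_power norm_mult \<rho>_def)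
    also have "\<dots> \<le> (\<Sum>k. (\<rho> * exp s) ^ k /\<^sub>R fact k)"
      by (intro sum_le_suminf summable_exp_generic) (auto simp: \<rho>_def)
    also have "\<dots> = exp (\<rho> * exp s)"
      by (simp add: sums_unique[OF exp_converges])
    finally have "norm (f n s) \<le> norm (exp (\<xi> * of_real s - of_real (exp s))) * exp (\<rho> * exp s)"
      unfolding f_def sum_distrib_left[symmetric] norm_mult by (intro mult_left_mono) auto
    also have "\<dots> = D s"
      by (simp add: D_def norm_exp_eq_Re mult_exp_exp algebra_simps)
    finally show "norm (f n s) \<le> D s" .
  qed
  have meas: "f n \<in> borel_measurable lborel" for n
    unfolding f_def by measurable
  have meas': "(\<lambda>s. exp (\<xi> * of_real s - z * of_real (exp s))) \<in> borel_measurable lborel"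
    by measurable
  show ?thesis
    unfolding has_bochner_integral_iff
    using integral_dominated_convergence[OF meas' meas D lim bound]
      integrable_dominated_convergence[OF meas' meas D lim bound] lim1 LIMSEQ_unique by blast
qed

proposition has_bochner_integral_Gamma_exp_complex:
  assumes \<xi>: "Re \<xi> > 0" and z: "Re z > 0"
  shows "has_bochner_integral lborel (\<lambda>s. exp (\<xi> * of_real s - z * of_real (exp s)))
           (Gamma \<xi> * z powr (-\<xi>))"
proof -
  \<comment> \<open>With this r, |r - z|^2 = r^2 - 2 r Re z + |z|^2 = r^2 - |z|^2 < r^2, so z / r
    lies in the disc of the binomial series.\<close>
  define r where "r = (norm z)\<^sup>2 / Re z"
  have "z \<noteq> 0" using z by auto
  then have r: "r > 0" using z by (simp add: r_def)
  define \<zeta> where "\<zeta> = z / of_real r"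
  have "(norm (of_real r - z))\<^sup>2 = r\<^sup>2 - 2 * r * Re z + (norm z)\<^sup>2"
    by (simp only: cmod_power2) (simp add: power2_eq_square algebra_simps)
  also have "\<dots> = r\<^sup>2 - (norm z)\<^sup>2" using z by (simp add: r_def)
  also have "\<dots> < r\<^sup>2" using \<open>z \<noteq> 0\<close> by simp
  finally have "norm (of_real r - z) < r"
    using r by (auto intro: power2_less_imp_less)
  moreover have "1 - \<zeta> = (of_real r - z) / of_real r" using r by (simp add: \<zeta>_def field_simps)
  ultimately have "norm (1 - \<zeta>) < 1" using r by (simp add: norm_divide)
  from has_bochner_integral_Gamma_exp_scale[OF has_bochner_integral_Gamma_exp_near_1[OF \<xi> this] r]
  show ?thesis using r \<open>z \<noteq> 0\<close> by (simp add: \<zeta>_def)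
qed

subsection \<open>Decay of Gamma on vertical lines and Mellin inversion\<close>

text \<open>On the ray z = cis \<eta> the Gamma integral equals Gamma (\<gamma> + i t) times a power
  of modulus exp (t \<eta>), while the integral of the moduli depends on neither t nor the sign of
  \<eta>. Taking \<eta> = \<theta> or -\<theta> according to the sign of t gives the decay.\<close>

lemma Gamma_vertical_line_decay:
  assumes "\<gamma> > 0" "0 \<le> \<theta>" "\<theta> < pi / 2"
  obtains C where "C \<ge> 0" "\<And>t. norm (Gamma (Complex \<gamma> t)) \<le> C * exp (- \<theta> * \<bar>t\<bar>)"
proof
  define C where "C = (\<integral>s. exp (\<gamma> * s - cos \<theta> * exp s) \<partial>lborel)"
  show "C \<ge> 0" unfolding C_def by (intro Bochner_Integration.integral_nonneg) auto
  have *: "norm (Gamma (Complex \<gamma> t)) * exp (t * \<eta>) \<le> C" if "\<bar>\<eta>\<bar> = \<theta>" for t \<eta> :: real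
  proof -
    have \<eta>: "\<bar>\<eta>\<bar> < pi / 2" using that assms by simp
    then have "Re (cis \<eta>) > 0" by (auto intro!: cos_gt_zero_pi)
    then have hb: "has_bochner_integral lborel
        (\<lambda>s. exp (Complex \<gamma> t * of_real s - cis \<eta> * of_real (exp s)))
        (Gamma (Complex \<gamma> t) * cis \<eta> powr (- Complex \<gamma> t))"
      using assms by (intro has_bochner_integral_Gamma_exp_complex) auto
    have "Ln (cis \<eta>) = \<i> * of_real \<eta>"
      using \<eta> by (auto simp: cis_conv_exp intro!: Ln_exp)
    then have "norm (cis \<eta> powr (- Complex \<gamma> t)) = exp (t * \<eta>)"
      by (simp add: powr_def norm_exp_eq_Re)
    then have "norm (Gamma (Complex \<gamma> t)) * exp (t * \<eta>) =
        norm (Gamma (Complex \<gamma> t) * cis \<eta> powr (- Complex \<gamma> t))"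
      by (simp add: norm_mult)
    also have "\<dots> \<le> (\<integral>s. norm (exp (Complex \<gamma> t * of_real s - cis \<eta> * of_real (exp s))) \<partial>lborel)"
      using hb by (metis has_bochner_integral_integral_eq integral_norm_bound)
    also have "\<dots> = C"
      using that by (auto simp: C_def norm_exp_eq_Re abs_if split: if_splits)
    finally show ?thesis .
  qed
  show "norm (Gamma (Complex \<gamma> t)) \<le> C * exp (- \<theta> * \<bar>t\<bar>)" for t
    using *[of "if t \<ge> 0 then \<theta> else - \<theta>" t] assms by (auto simp: exp_minus field_simps abs_if split: if_splits)
qed

lemma integrable_exponential_density:
  assumes "l > 0"
  shows "integrable lborel (exponential_density l)"
proof -
  interpret prob_space "density lborel (exponential_density l)"
    using assms by (rule prob_space_exponential_density)
  have "integrable (density lborel (exponential_density l)) (\<lambda>_. 1::real)" by simp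
  then show ?thesis
    using assms by (subst (asm) integrable_density) (auto simp: exponential_density_nonneg)
qed

lemma integrable_exp_minus_abs:
  assumes "\<delta> > 0"
  shows "integrable lborel (\<lambda>t::real. exp (- \<delta> * \<bar>t\<bar>))"
proof -
  have e: "integrable lborel (exponential_density \<delta>)"
    using assms by (rule integrable_exponential_density)
  then have "integrable lborel (\<lambda>t. exponential_density \<delta> (0 + (-1) * t))"
    by (rule lborel_integrable_real_affine) simp
  \<comment> \<open>At t = 0 the density and its reflection both contribute, so this sum only
    dominates the target there, which is enough.\<close>
  with e have "integrable lborel (\<lambda>t. (exponential_density \<delta> t + exponential_density \<delta> (0 + (-1) * t)) / \<delta>)"
    by auto
  then show ?thesis
    by (rule Bochner_Integration.integrable_bound)
       (use assms in \<open>auto simp: exponential_density_def mult.commute\<close>)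
qed

lemma continuous_on_Gamma_vertical_line:
  assumes "\<gamma> > 0"
  shows "continuous_on UNIV (\<lambda>t. Gamma (Complex \<gamma> t))"
proof (rule continuous_on_compose2[where g = Gamma and f = "Complex \<gamma>" and t = "{z. Re z > 0}"])
  show "continuous_on {z::complex. Re z > 0} Gamma"
    by (intro continuous_on_Gamma) (auto elim!: nonpos_Ints_cases)
  show "continuous_on UNIV (Complex \<gamma>)"
    unfolding Complex_eq by (intro continuous_intros)
qed (use assms in auto)

lemma measurable_Gamma_vertical_line [measurable]:
  assumes "\<gamma> > 0"
  shows "(\<lambda>t. Gamma (Complex \<gamma> t)) \<in> borel_measurable borel"
  using borel_measurable_continuous_onI[OF continuous_on_Gamma_vertical_line[OF assms]] .

lemma measurable_powr_vertical_line [measurable]: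
  "(\<lambda>t. z powr (- Complex \<gamma> t)) \<in> borel_measurable borel"
  unfolding powr_def Complex_eq by measurable

text \<open>The power grows at most like exp (|arg z| |t|), with |arg z| < pi / 2 as z lies in the
  right half-plane. Gamma decays at any rate below pi / 2, hence faster.\<close>

lemma integrable_Gamma_powr_vertical_line:
  assumes \<gamma>: "\<gamma> > 0" and z: "Re z > 0"
  shows "integrable lborel (\<lambda>t. Gamma (Complex \<gamma> t) * z powr (- Complex \<gamma> t))"
proof -
  have nz: "z \<noteq> 0" using z by auto
  define \<beta> where "\<beta> = \<bar>Im (Ln z)\<bar>"
  have \<beta>: "0 \<le> \<beta>" "\<beta> < pi / 2" using z nz Re_Ln_pos_lt[of z] by (auto simp: \<beta>_def)
  \<comment> \<open>The midpoint of |arg z| and pi / 2 leaves the positive net decay rate \<theta> -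
    \<beta>.\<close>
  define \<theta> where "\<theta> = (\<beta> + pi / 2) / 2"
  have \<theta>: "0 \<le> \<theta>" "\<theta> < pi / 2" "\<beta> < \<theta>" using \<beta> by (auto simp: \<theta>_def)
  obtain C where C: "C \<ge> 0" "\<And>t. norm (Gamma (Complex \<gamma> t)) \<le> C * exp (- \<theta> * \<bar>t\<bar>)"
    using Gamma_vertical_line_decay[OF \<gamma> \<theta>(1,2)] by blast
  have "integrable lborel (\<lambda>t. C * exp (- \<gamma> * ln (norm z)) * exp (- (\<theta> - \<beta>) * \<bar>t\<bar>))"
    using \<theta> by (intro integrable_mult_right integrable_exp_minus_abs) auto
  then show ?thesis
  proof (rule Bochner_Integration.integrable_bound)
    show "(\<lambda>t. Gamma (Complex \<gamma> t) * z powr (- Complex \<gamma> t)) \<in> borel_measurable lborel"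
      using \<gamma> by measurable
    show "AE t in lborel. norm (Gamma (Complex \<gamma> t) * z powr (- Complex \<gamma> t))
        \<le> norm (C * exp (- \<gamma> * ln (norm z)) * exp (- (\<theta> - \<beta>) * \<bar>t\<bar>))"
    proof (intro AE_I2)
      fix t :: real
      have "t * Im (Ln z) \<le> \<beta> * \<bar>t\<bar>"
        unfolding \<beta>_def by (metis abs_ge_self abs_mult mult.commute)
      then have "norm (z powr (- Complex \<gamma> t)) \<le> exp (- \<gamma> * ln (norm z)) * exp (\<beta> * \<bar>t\<bar>)"
        using nz by (simp add: powr_def norm_exp_eq_Re mult_exp_exp)
      then have "norm (Gamma (Complex \<gamma> t) * z powr (- Complex \<gamma> t)) \<le>
          (C * exp (- \<theta> * \<bar>t\<bar>)) * (exp (- \<gamma> * ln (norm z)) * exp (\<beta> * \<bar>t\<bar>))"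
        unfolding norm_mult using C by (intro mult_mono) auto
      also have "\<dots> = norm (C * exp (- \<gamma> * ln (norm z)) * exp (- (\<theta> - \<beta>) * \<bar>t\<bar>))"
        using C by (simp add: mult_exp_exp algebra_simps)
      finally show "norm (Gamma (Complex \<gamma> t) * z powr (- Complex \<gamma> t))
        \<le> norm (C * exp (- \<gamma> * ln (norm z)) * exp (- (\<theta> - \<beta>) * \<bar>t\<bar>))" .
    qed
  qed
qed

section \<open>Fourier inversion at the origin\<close>

lemma gaussian_fourier:
  shows "integrable lborel (\<lambda>x::real. exp (- x\<^sup>2 / 2))"
    and "(\<integral>x. exp (- x\<^sup>2 / 2) \<partial>lborel) = sqrt (2 * pi)"
    and "(\<integral>x. cis (u * x) * of_real (exp (- x\<^sup>2 / 2)) \<partial>lborel) = of_real (sqrt (2 * pi) * exp (- u\<^sup>2 / 2))"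
proof -
  \<comment> \<open>All three claims are rescaled facts about the standard normal law:
    integrability, total mass one and the characteristic function.\<close>
  have e: "exp (- x\<^sup>2 / 2) = sqrt (2 * pi) * std_normal_density x" for x :: real
    by (simp add: std_normal_density_def)
  show "integrable lborel (\<lambda>x::real. exp (- x\<^sup>2 / 2))"
    unfolding e by (intro integrable_mult_right integrable_normal_density) auto
  show "(\<integral>x. exp (- x\<^sup>2 / 2) \<partial>lborel) = sqrt (2 * pi)"
    unfolding e by (subst integral_mult_right_zero) (simp add: integral_normal_density)
  have "of_real (exp (- u\<^sup>2 / 2)) = char std_normal_distribution u"
    by (simp add: char_std_normal_distribution)
  also have "\<dots> = (\<integral>x. std_normal_density x *\<^sub>R cis (u * x) \<partial>lborel)"
    unfolding char_def by (subst integral_density) (auto simp: cis_conv_exp)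
  finally have "of_real (exp (- u\<^sup>2 / 2)) = (\<integral>x. std_normal_density x *\<^sub>R cis (u * x) \<partial>lborel)" .
  moreover have "(\<integral>x. cis (u * x) * of_real (exp (- x\<^sup>2 / 2)) \<partial>lborel) =
     (\<integral>x. of_real (sqrt (2 * pi)) * (std_normal_density x *\<^sub>R cis (u * x)) \<partial>lborel)"
    by (intro Bochner_Integration.integral_cong refl) (simp add: e[simplified] scaleR_conv_of_real mult_ac)
  ultimately show "(\<integral>x. cis (u * x) * of_real (exp (- x\<^sup>2 / 2)) \<partial>lborel) = of_real (sqrt (2 * pi) * exp (- u\<^sup>2 / 2))"
    by (simp only: integral_mult_right_zero of_real_mult)
qed

lemma measurable_cis [measurable]: "cis \<in> borel_measurable borel"
  by (intro borel_measurable_continuous_onI continuous_intros)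

text \<open>Weighting the transform G of g by h (t / m), with h Gaussian, and exchanging integrals
  gives sqrt (2 pi) times the integral of g (x / m) h (x). As m grows, dominated convergence applies
  on both sides, by integrability of G and boundedness of g. The limits are the integral of G and 2
  pi g 0, since h is 1 at 0 and has integral sqrt (2 pi).\<close>

proposition fourier_inversion_at_0:
  fixes g :: "real \<Rightarrow> complex"
  assumes g: "integrable lborel g" and bd: "\<And>s. norm (g s) \<le> B" and cont: "isCont g 0"
    and ghat: "integrable lborel (\<lambda>t. \<integral>s. g s * cis (t * s) \<partial>lborel)"
  shows "(\<integral>t. \<integral>s. g s * cis (t * s) \<partial>lborel \<partial>lborel) = of_real (2 * pi) * g 0"
proof -
  have [measurable]: "g \<in> borel_measurable borel" using g by auto
  define h where "h = (\<lambda>x::real. exp (- x\<^sup>2 / 2))"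
  have [measurable]: "h \<in> borel_measurable borel" unfolding h_def by measurable
  have h: "integrable lborel h" "integral\<^sup>L lborel h = sqrt (2 * pi)"
    "\<And>u. (\<integral>x. cis (u * x) * of_real (h x) \<partial>lborel) = of_real (sqrt (2 * pi) * h u)"
    unfolding h_def by (fact gaussian_fourier)+
  have h01: "0 \<le> h x" "h x \<le> 1" for x by (auto simp: h_def)
  have contf: "isCont h 0" unfolding h_def by (intro continuous_intros) auto
  have inv0: "(\<lambda>n. inverse (real (Suc n)) * x) \<longlonglongrightarrow> 0" for x :: real
    using tendsto_mult[OF LIMSEQ_inverse_real_of_nat tendsto_const[of x]] by simp
  define G where "G = (\<lambda>t. \<integral>s. g s * cis (t * s) \<partial>lborel)"
  have [measurable]: "G \<in> borel_measurable borel"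
    unfolding G_def by measurable
  have G: "integrable lborel G" using ghat by (simp add: G_def)
  have lim1: "(\<lambda>n. \<integral>t. G t * of_real (h (inverse (real (Suc n)) * t)) \<partial>lborel) \<longlonglongrightarrow> integral\<^sup>L lborel G"
  proof (rule integral_dominated_convergence)
    show "integrable lborel (\<lambda>t. norm (G t))" using G by auto
    show "AE t in lborel. (\<lambda>n. G t * of_real (h (inverse (real (Suc n)) * t))) \<longlonglongrightarrow> G t"
    proof (intro AE_I2)
      fix t
      have "(\<lambda>n. G t * of_real (h (inverse (real (Suc n)) * t))) \<longlonglongrightarrow> G t * of_real (h 0)"
        by (intro tendsto_intros isCont_tendsto_compose[OF contf] inv0)
      then show "(\<lambda>n. G t * of_real (h (inverse (real (Suc n)) * t))) \<longlonglongrightarrow> G t" by (simp add: h_def)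
    qed
    show "AE t in lborel. norm (G t * of_real (h (inverse (real (Suc n)) * t))) \<le> norm (G t)" for n
      using h01 by (intro AE_I2) (auto simp: norm_mult intro!: mult_left_le)
  qed auto
  have lim2: "(\<lambda>n. \<integral>x. g (inverse (real (Suc n)) * x) * of_real (h x) \<partial>lborel) \<longlonglongrightarrow>
     (\<integral>x. g 0 * of_real (h x) \<partial>lborel)"
  proof (rule integral_dominated_convergence)
    show "integrable lborel (\<lambda>x. B * h x)" using h by auto
    show "AE x in lborel. (\<lambda>n. g (inverse (real (Suc n)) * x) * of_real (h x)) \<longlonglongrightarrow> g 0 * of_real (h x)"
      by (intro AE_I2 tendsto_intros isCont_tendsto_compose[OF cont] inv0)
    show "AE x in lborel. norm (g (inverse (real (Suc n)) * x) * of_real (h x)) \<le> B * h x" for n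
      using h01 bd by (intro AE_I2) (auto simp: norm_mult intro!: mult_right_mono)
  qed auto
  have eq: "(\<integral>t. G t * of_real (h (inverse (real (Suc n)) * t)) \<partial>lborel) =
      of_real (sqrt (2 * pi)) * (\<integral>x. g (inverse (real (Suc n)) * x) * of_real (h x) \<partial>lborel)" for n
  proof -
    define m where "m = real (Suc n)"
    have m: "m > 0" by (simp add: m_def)
    define F where "F = (\<lambda>(t, s). g s * cis (t * s) * of_real (h (inverse m * t)))"
    have [measurable]: "F \<in> borel_measurable (lborel \<Otimes>\<^sub>M lborel)" unfolding F_def by measurable
    have hm: "integrable lborel (\<lambda>t. h (inverse m * t))"
      using lborel_integrable_real_affine[OF h(1), of "inverse m" 0] m by simp
    \<comment> \<open>The modulus of g s cis (t s) does not depend on t; the Gaussian weight is what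
      makes the double integral absolutely convergent.\<close>
    have intF: "integrable (lborel \<Otimes>\<^sub>M lborel) F"
    proof (rule lborel_pair.Fubini_integrable)
      have "(\<lambda>t. \<integral>s. norm (F (t, s)) \<partial>lborel) = (\<lambda>t. (\<integral>s. norm (g s) \<partial>lborel) * h (inverse m * t))"
        using h01 by (simp add: F_def norm_mult fun_eq_iff)
      then show "integrable lborel (\<lambda>t. \<integral>s. norm (F (t, s)) \<partial>lborel)"
        using hm by simp
      show "AE t in lborel. integrable lborel (\<lambda>s. F (t, s))"
      proof (intro AE_I2)
        fix t
        have "integrable lborel (\<lambda>s. norm (g s) * h (inverse m * t))" using g by auto
        then show "integrable lborel (\<lambda>s. F (t, s))"
          by (rule Bochner_Integration.integrable_bound) (use h01 in \<open>auto simp: F_def norm_mult\<close>)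
      qed
    qed auto
    have "(\<integral>t. G t * of_real (h (inverse m * t)) \<partial>lborel) = (\<integral>t. \<integral>s. F (t, s) \<partial>lborel \<partial>lborel)"
      by (simp add: G_def F_def)
    also have "\<dots> = (\<integral>s. \<integral>t. F (t, s) \<partial>lborel \<partial>lborel)"
      using lborel_pair.Fubini_integral[of "\<lambda>t s. F (t, s)"] intF by simp
    \<comment> \<open>The Gaussian reproduces itself under the transform, with the factor m sqrt (2
      pi); the m cancels when s is rescaled by 1 / m below.\<close>
    also have "(\<lambda>s. \<integral>t. F (t, s) \<partial>lborel) = (\<lambda>s. g s * of_real (m * sqrt (2 * pi) * h (m * s)))"
    proof
      fix s
      have "(\<integral>t. F (t, s) \<partial>lborel) = g s * (\<integral>t. cis (t * s) * of_real (h (inverse m * t)) \<partial>lborel)"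
        by (simp add: F_def mult.assoc)
      also have "(\<integral>t. cis (t * s) * of_real (h (inverse m * t)) \<partial>lborel) =
          \<bar>m\<bar> *\<^sub>R (\<integral>x. cis ((0 + m * x) * s) * of_real (h (inverse m * (0 + m * x))) \<partial>lborel)"
        using m by (subst lborel_integral_real_affine[of m _ 0]) auto
      also have "\<dots> = of_real m * (\<integral>x. cis ((m * s) * x) * of_real (h x) \<partial>lborel)"
        using m by (simp add: scaleR_conv_of_real mult_ac)
      also have "\<dots> = of_real (m * sqrt (2 * pi) * h (m * s))"
        by (subst h(3)) simp
      finally show "(\<integral>t. F (t, s) \<partial>lborel) = g s * of_real (m * sqrt (2 * pi) * h (m * s))" .
    qed
    also have "(\<integral>s. g s * of_real (m * sqrt (2 * pi) * h (m * s)) \<partial>lborel) =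
       of_real (m * sqrt (2 * pi)) * (\<integral>s. g s * of_real (h (m * s)) \<partial>lborel)"
      by (subst integral_mult_right_zero[symmetric]) (simp add: mult_ac)
    also have "(\<integral>s. g s * of_real (h (m * s)) \<partial>lborel) =
       \<bar>inverse m\<bar> *\<^sub>R (\<integral>x. g (0 + inverse m * x) * of_real (h (m * (0 + inverse m * x))) \<partial>lborel)"
      using m by (subst lborel_integral_real_affine[of "inverse m" _ 0]) auto
    also have "of_real (m * sqrt (2 * pi)) * \<dots> =
        of_real (sqrt (2 * pi)) * (\<integral>x. g (inverse m * x) * of_real (h x) \<partial>lborel)"
      using m by (simp add: scaleR_conv_of_real mult.assoc[symmetric])
    finally show ?thesis by (simp add: m_def)
  qed
  have "integral\<^sup>L lborel G = of_real (sqrt (2 * pi)) * (\<integral>x. g 0 * of_real (h x) \<partial>lborel)"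
    using lim1 tendsto_mult_left[OF lim2, of "of_real (sqrt (2 * pi))"] unfolding eq
    by (rule LIMSEQ_unique)
  also have "\<dots> = of_real (sqrt (2 * pi)) * (g 0 * of_real (sqrt (2 * pi)))"
    by (simp add: h(2))
  also have "\<dots> = of_real (sqrt (2 * pi) * sqrt (2 * pi)) * g 0" by (simp only: of_real_mult mult_ac)
  finally show ?thesis by (simp add: G_def)
qed

text \<open>After u = exp s, the Mellin transform of exp (-z u) on the line Re = \<gamma> is the
  Fourier transform of \<open>g\<close>, and the point u = 1 becomes s = 0. Inversion at this single
  point suffices because other values of u can be absorbed into z.\<close>

proposition exp_minus_Mellin_inversion:
  assumes \<gamma>: "\<gamma> > 0" and z: "Re z > 0"
  shows "(\<integral>t. Gamma (Complex \<gamma> t) * z powr (- Complex \<gamma> t) \<partial>lborel) = of_real (2 * pi) * exp (- z)"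
proof -
  define g where "g = (\<lambda>s. exp (of_real \<gamma> * of_real s - z * of_real (exp s)))"
  have ghat: "(\<integral>s. g s * cis (t * s) \<partial>lborel) = Gamma (Complex \<gamma> t) * z powr (- Complex \<gamma> t)" for t
  proof -
    have "(\<lambda>s. g s * cis (t * s)) = (\<lambda>s. exp (Complex \<gamma> t * of_real s - z * of_real (exp s)))"
      by (simp add: fun_eq_iff g_def cis_conv_exp mult_exp_exp Complex_eq algebra_simps)
    then show ?thesis
      using has_bochner_integral_Gamma_exp_complex[of "Complex \<gamma> t" z] \<gamma> z
      by (simp add: has_bochner_integral_iff)
  qed
  \<comment> \<open>The modulus of g s is exp (\<gamma> s - Re z e^s), bounded because exp s
    outgrows s. The constant comes from the linear inequality below, multiplied by \<gamma>.\<close>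
  have "norm (g s) \<le> exp (\<gamma> * (\<gamma> / Re z))" for s
  proof -
    have "s \<le> \<gamma> / Re z + exp s * Re z / \<gamma>"
    proof (cases "s \<le> 0")
      case True
      then show ?thesis using \<gamma> z by (intro order.trans[OF True]) auto
    next
      case False
      define k where "k = Re z / \<gamma>"
      have k: "k > 0" using \<gamma> z by (simp add: k_def)
      \<comment> \<open>Squaring s / 2 <= exp (s / 2) bounds exp s below by a quadratic, and s <= 1
        / k + k s^2 / 4 is the arithmetic-geometric mean inequality.\<close>
      have "s * s / 4 \<le> exp s"
      proof -
        have "s / 2 \<le> exp (s / 2)" using exp_ge_add_one_self[of "s / 2"] by linarith
        then have "(s / 2) * (s / 2) \<le> exp (s / 2) * exp (s / 2)" using False by (intro mult_mono) auto
        then show ?thesis by (simp add: mult_exp_exp)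
      qed
      moreover have "s \<le> inverse k + (s * s / 4) * k"
      proof -
        have "0 \<le> (s * k / 2 - 1)\<^sup>2" by simp
        then have "s * k \<le> 1 + (s * s / 4) * k * k" by (simp add: power2_eq_square algebra_simps)
        then show ?thesis using k by (simp add: field_simps)
      qed
      ultimately have "s \<le> inverse k + exp s * k"
        using k by (smt (verit) mult_right_mono)
      then show ?thesis by (simp add: k_def)
    qed
    then have "\<gamma> * s \<le> \<gamma> * (\<gamma> / Re z + exp s * Re z / \<gamma>)"
      using \<gamma> by (intro mult_left_mono) auto
    then show ?thesis using \<gamma> by (simp add: g_def norm_exp_eq_Re algebra_simps)
  qed
  moreover have "integrable lborel g"
    using has_bochner_integral_Gamma_exp_complex[of "of_real \<gamma>" z] \<gamma> z
    by (simp add: has_bochner_integral_iff g_def)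
  moreover have "isCont g 0" unfolding g_def by (intro continuous_intros)
  moreover have "integrable lborel (\<lambda>t. \<integral>s. g s * cis (t * s) \<partial>lborel)"
    unfolding ghat using \<gamma> z by (rule integrable_Gamma_powr_vertical_line)
  ultimately have "(\<integral>t. \<integral>s. g s * cis (t * s) \<partial>lborel \<partial>lborel) = of_real (2 * pi) * g 0"
    by (intro fourier_inversion_at_0) auto
  then show ?thesis unfolding ghat by (simp add: g_def)
qed

subsection \<open>The Mellin--Barnes integral\<close>

text \<open>Mellin inversion is applied to z = W e^(a s). The remaining s-integral is a Gamma
  integral with exponent 1 - a \<xi>, whose real part on the line is positive by a \<gamma> <
  1.\<close>

proposition exp_power_integral_Mellin_Barnes:
  assumes \<gamma>: "0 < \<gamma>" "a * \<gamma> < 1" and A: "Re A > 0" and W: "Re W > 0"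
  shows "of_real (2 * pi) * (\<integral>s. exp (of_real s - A * of_real (exp s) - W * of_real (exp (a * s))) \<partial>lborel) =
    (\<integral>t. Gamma (Complex \<gamma> t) * Gamma (1 - of_real a * Complex \<gamma> t) *
         (W powr (- Complex \<gamma> t) * A powr (of_real a * Complex \<gamma> t - 1)) \<partial>lborel)"
proof -
  define K where "K = (\<lambda>t. Gamma (Complex \<gamma> t) * W powr (- Complex \<gamma> t))"
  have K: "integrable lborel K"
    unfolding K_def using \<gamma>(1) W by (rule integrable_Gamma_powr_vertical_line)
  have [measurable]: "K \<in> borel_measurable borel" using K by auto
  define E where "E = (\<lambda>t s. exp ((1 - of_real a * Complex \<gamma> t) * of_real s - A * of_real (exp s)))"
  have E: "has_bochner_integral lborel (E t)
      (Gamma (1 - of_real a * Complex \<gamma> t) * A powr (of_real a * Complex \<gamma> t - 1))" for t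
    using has_bochner_integral_Gamma_exp_complex[of "1 - of_real a * Complex \<gamma> t" A] \<gamma> A
    by (simp add: E_def)
  \<comment> \<open>The modulus of \<open>E\<close> is independent of t, so the double integral of
    moduli factorises and Fubini applies.\<close>
  have normE: "norm (E t s) = exp ((1 - a * \<gamma>) * s - Re A * exp s)" for t s
    by (simp add: E_def norm_exp_eq_Re)
  define F where "F = (\<lambda>(t, s). K t * E t s)"
  have F [measurable]: "F \<in> borel_measurable (lborel \<Otimes>\<^sub>M lborel)"
    unfolding F_def E_def Complex_eq by measurable
  have "integrable (lborel \<Otimes>\<^sub>M lborel) F"
  proof (rule lborel_pair.Fubini_integrable[OF F])
    have "(\<lambda>t. \<integral>s. norm (F (t, s)) \<partial>lborel) = (\<lambda>t. norm (K t) * (\<integral>s. exp ((1 - a * \<gamma>) * s - Re A * exp s) \<partial>lborel))"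
      by (simp add: F_def norm_mult normE)
    then show "integrable lborel (\<lambda>t. \<integral>s. norm (F (t, s)) \<partial>lborel)"
      using K by simp
    show "AE t in lborel. integrable lborel (\<lambda>s. F (t, s))"
      using E by (auto simp: F_def has_bochner_integral_iff)
  qed
  then have "(\<integral>s. \<integral>t. F (t, s) \<partial>lborel \<partial>lborel) = (\<integral>t. \<integral>s. F (t, s) \<partial>lborel \<partial>lborel)"
    using lborel_pair.Fubini_integral[of "\<lambda>t s. F (t, s)"] by simp
  also have "(\<lambda>t. \<integral>s. F (t, s) \<partial>lborel) = (\<lambda>t. Gamma (Complex \<gamma> t) * Gamma (1 - of_real a * Complex \<gamma> t) *
         (W powr (- Complex \<gamma> t) * A powr (of_real a * Complex \<gamma> t - 1)))"
    using E by (simp add: F_def K_def has_bochner_integral_iff mult_ac)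
  also have "(\<lambda>s. \<integral>t. F (t, s) \<partial>lborel) =
      (\<lambda>s. of_real (2 * pi) * exp (of_real s - A * of_real (exp s) - W * of_real (exp (a * s))))"
  proof
    fix s :: real
    have nz: "W \<noteq> 0" using W by auto
    have "F (t, s) = exp (of_real s - A * of_real (exp s)) *
        (Gamma (Complex \<gamma> t) * (of_real (exp (a * s)) * W) powr (- Complex \<gamma> t))" for t
    proof -
      \<comment> \<open>The factor exp (a s) is positive real, so it does not change the branch and
        can be pulled out of the power.\<close>
      have "Ln (of_real (exp (a * s)) * W) = of_real (a * s) + Ln W"
        using nz by (subst Ln_times_of_real) (auto simp: Ln_of_real simp del: of_real_exp)
      then have "(of_real (exp (a * s)) * W) powr (- Complex \<gamma> t) =
          exp (- of_real a * Complex \<gamma> t * of_real s) * W powr (- Complex \<gamma> t)"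
        using nz by (simp add: powr_def mult_exp_exp algebra_simps)
      then show ?thesis
        by (simp add: F_def K_def E_def mult_exp_exp algebra_simps)
    qed
    then have "(\<integral>t. F (t, s) \<partial>lborel) = exp (of_real s - A * of_real (exp s)) *
       (\<integral>t. Gamma (Complex \<gamma> t) * (of_real (exp (a * s)) * W) powr (- Complex \<gamma> t) \<partial>lborel)"
      by simp
    also have "\<dots> = exp (of_real s - A * of_real (exp s)) * (of_real (2 * pi) * exp (- (of_real (exp (a * s)) * W)))"
      using \<gamma> W by (subst exp_minus_Mellin_inversion) auto
    also have "\<dots> = of_real (2 * pi) * exp (of_real s - A * of_real (exp s) - W * of_real (exp (a * s)))"
      by (simp add: mult_exp_exp mult_ac)
    finally show "(\<integral>t. F (t, s) \<partial>lborel) =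
      of_real (2 * pi) * exp (of_real s - A * of_real (exp s) - W * of_real (exp (a * s)))" .
  qed
  finally show ?thesis by simp
qed

section \<open>Principal branches of logarithms and powers\<close>

lemma abs_Im_Ln_add_pos_le:
  assumes B: "Re B > 0" and k: "k > 0"
  shows "\<bar>Im (Ln (of_real k + B))\<bar> \<le> \<bar>Im (Ln B)\<bar>"
proof -
  \<comment> \<open>In the right half-plane arguments are compared through the slopes |Im| / Re, and
    adding k enlarges the denominator.\<close>
  have *: "\<bar>Im (Ln z)\<bar> = arctan (\<bar>Im z\<bar> / Re z)" if "Re z > 0" for z
  proof -
    have "z \<noteq> 0" using that by auto
    then have "Im (Ln z) = arctan (Im z / Re z)" using that by (simp add: Arg_eq_Im_Ln[symmetric] arg_conv_arctan)
    moreover have "\<bar>arctan x\<bar> = arctan \<bar>x\<bar>" for x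
      by (auto simp: abs_if arctan_minus)
    ultimately show ?thesis using that by simp
  qed
  have "\<bar>Im B\<bar> / (k + Re B) \<le> \<bar>Im B\<bar> / Re B"
    using B k by (intro divide_left_mono) auto
  then show ?thesis using B k by (simp add: * arctan_le_iff)
qed

text \<open>Multiplying by b in (0, 1] never moves the imaginary part away from 0, so it stays in
  the strip (-pi, pi] of the principal logarithm.\<close>

lemma Ln_powr_of_real:
  assumes "w \<noteq> 0" "0 < b" "b \<le> 1"
  shows "Ln (w powr of_real b) = of_real b * Ln w"
proof (rule Ln_unique)
  show "exp (of_real b * Ln w) = w powr of_real b" using assms by (simp add: powr_def)
  show "- pi < Im (of_real b * Ln w)"
  proof (cases "Im (Ln w) \<ge> 0")
    case True
    then have "0 \<le> b * Im (Ln w)" using assms by simp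
    then show ?thesis by simp (metis less_le_trans neg_less_0_iff_less pi_gt_zero)
  next
    case False
    then have "Im (Ln w) \<le> b * Im (Ln w)" using assms by (simp add: mult_le_cancel_right1)
    then show ?thesis using mpi_less_Im_Ln[OF assms(1)] by simp
  qed
  show "Im (of_real b * Ln w) \<le> pi"
  proof (cases "Im (Ln w) \<ge> 0")
    case True
    then have "b * Im (Ln w) \<le> Im (Ln w)" using assms by (simp add: mult_left_le_one_le)
    then show ?thesis using Im_Ln_le_pi[OF assms(1)] by simp
  next
    case False
    then have "b * Im (Ln w) \<le> 0" using assms by (simp add: mult_nonneg_nonpos)
    then show ?thesis by (simp add: order.trans[OF _ pi_ge_zero])
  qed
qed

text \<open>The argument, scaled by b <= 1, stays below pi / 2 in modulus. This places
  w^(2/\<alpha>), and hence the complex scale A, in the right half-plane.\<close>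

lemma Re_powr_of_real_pos:
  assumes "Re w > 0" "0 < b" "b \<le> 1"
  shows "Re (w powr of_real b) > 0"
proof -
  have nz: "w \<noteq> 0" using assms by auto
  have "\<bar>b * Im (Ln w)\<bar> \<le> \<bar>Im (Ln w)\<bar>"
    using assms by (auto simp: abs_mult intro!: mult_left_le_one_le)
  also have "\<dots> < pi / 2" using assms by (intro Re_Ln_pos_lt_imp)
  finally have "\<bar>Im (Ln (w powr of_real b))\<bar> < pi / 2"
    using Ln_powr_of_real[of w b] assms nz by simp
  then show ?thesis using Re_Ln_pos_lt[of "w powr of_real b"] nz by simp
qed

text \<open>The argument of \<open>A\<close> is at most \<open>1 / a\<close> times that of \<open>w\<close>, so no branch cut is crossed although
  \<open>A powr (- a)\<close> multiplies arguments by an arbitrarily large factor.\<close>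

lemma powr_mult_powr_sector:
  assumes w: "Re w > 0" and a: "a \<ge> 1" and pos: "p > 0" "k > 0" "om > 0" "q > 0"
  defines "A \<equiv> of_real p * (of_real k + of_real om * w powr of_real (1 / a))"
  shows "(of_real q * w * A powr (- of_real a)) powr (- \<xi>) =
         (of_real q * w) powr (- \<xi>) * A powr (of_real a * \<xi>)"
proof -
  define B where "B = w powr of_real (1 / a)"
  have nz: "w \<noteq> 0" using w by auto
  have B: "Re B > 0" unfolding B_def using w a by (intro Re_powr_of_real_pos) auto
  then have Bnz: "B \<noteq> 0" by auto
  have reA: "Re (of_real k + of_real om * B) > 0" using B pos by (auto intro!: add_pos_pos)
  then have "of_real k + of_real om * B \<noteq> 0" by (metis less_irrefl zero_complex.sel(1))
  then have Anz: "A \<noteq> 0" using pos by (simp add: A_def B_def)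
  have "\<bar>Im (Ln A)\<bar> = \<bar>Im (Ln (of_real k + of_real om * B))\<bar>"
    using pos \<open>of_real k + of_real om * B \<noteq> 0\<close> unfolding A_def B_def[symmetric] by (simp add: Ln_times_of_real)
  \<comment> \<open>Adding the positive constant can only shrink the argument, and without it the
    argument is that of w divided by a.\<close>
  also have "\<dots> \<le> \<bar>Im (Ln (of_real om * B))\<bar>"
    using B pos by (intro abs_Im_Ln_add_pos_le) auto
  also have "\<dots> = \<bar>Im (Ln w)\<bar> / a"
    using pos Bnz nz a Ln_powr_of_real[of w "1 / a"] by (simp add: Ln_times_of_real B_def abs_mult)
  finally have "\<bar>a * Im (Ln A)\<bar> \<le> \<bar>Im (Ln w)\<bar>"
    using a by (simp add: abs_mult field_simps)
  moreover have "\<bar>Im (Ln w)\<bar> < pi / 2" using w by (intro Re_Ln_pos_lt_imp)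
  \<comment> \<open>Both terms are below pi / 2 in modulus, so the candidate for the logarithm of X
    has imaginary part in (-pi, pi) and must be the principal value.\<close>
  ultimately have bd: "\<bar>Im (Ln w) - a * Im (Ln A)\<bar> < pi" by linarith
  have Lq: "Ln (of_real q * w) = of_real (ln q) + Ln w"
    using pos nz by (simp add: Ln_times_of_real Ln_of_real)
  define X where "X = of_real q * w * A powr (- of_real a)"
  have Xnz: "X \<noteq> 0" using pos nz Anz by (simp add: X_def)
  have LX: "Ln X = of_real (ln q) + Ln w - of_real a * Ln A"
  proof (rule Ln_unique)
    show "exp (of_real (ln q) + Ln w - of_real a * Ln A) = X"
      using pos nz Anz by (simp add: X_def exp_diff exp_add powr_def exp_minus exp_of_real divide_inverse)
  qed (use bd in auto)
  have "X powr (- \<xi>) = (of_real q * w) powr (- \<xi>) * A powr (of_real a * \<xi>)"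
    using pos nz Anz Xnz by (simp add: powr_def LX Lq mult_exp_exp) (simp add: algebra_simps)
  then show ?thesis by (simp add: X_def)
qed

subsection \<open>The squared minimal distance\<close>

lemma measurable_dist_density [measurable]: "dist_density c lb \<in> borel_measurable borel"
  unfolding dist_density_def by measurable

lemma space_dist_measure [simp]: "space (dist_measure c lb) = UNIV"
  and sets_dist_measure [simp, measurable_cong]: "sets (dist_measure c lb) = sets borel"
  by (auto simp: dist_measure_def)

lemma emeasure_dist_measure_greaterThan:
  assumes "c > 0" "lb > 0" "x \<ge> 0"
  shows "emeasure (dist_measure c lb) {x<..} = ennreal (exp (- c * lb * pi * x\<^sup>2))"
proof -
  define \<mu> where "\<mu> = c * lb * pi"
  have \<mu>: "\<mu> > 0" using assms by (simp add: \<mu>_def)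
  have "emeasure (dist_measure c lb) {x<..} = (\<integral>\<^sup>+y. ennreal (dist_density c lb y) * indicator {x<..} y \<partial>lborel)"
    unfolding dist_measure_def by (subst emeasure_density) auto
  \<comment> \<open>The boundary point is null, and the fundamental theorem of calculus is applied
    on the closed half-line. Since x >= 0, the density formula holds there without its case
    split.\<close>
  also have "\<dots> = (\<integral>\<^sup>+y. ennreal (2 * \<mu> * y * exp (- \<mu> * y\<^sup>2)) * indicator {x..} y \<partial>lborel)"
  proof (rule nn_integral_cong_AE)
    show "AE y in lborel. ennreal (dist_density c lb y) * indicator {x<..} y =
        ennreal (2 * \<mu> * y * exp (- \<mu> * y\<^sup>2)) * indicator {x..} y"
      using AE_lborel_singleton[of x]
      by eventually_elim (use assms in \<open>auto simp: dist_density_def \<mu>_def mult_ac split: split_indicator\<close>)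
  qed
  also have "\<dots> = ennreal (0 - (- exp (- \<mu> * x\<^sup>2)))"
  proof (rule nn_integral_FTC_atLeast)
    show "DERIV (\<lambda>y. - exp (- \<mu> * y\<^sup>2)) y :> 2 * \<mu> * y * exp (- \<mu> * y\<^sup>2)" for y
      by (auto intro!: derivative_eq_intros)
    have "LIM y at_top. (y::real)\<^sup>2 :> at_top"
      by (intro filterlim_pow_at_top filterlim_ident) simp
    then have "LIM y at_top. - \<mu> * y\<^sup>2 :> at_bot"
      using \<mu> by (intro filterlim_tendsto_neg_mult_at_bot[OF tendsto_const]) auto
    then have "((\<lambda>y. - exp (- \<mu> * y\<^sup>2)) \<longlongrightarrow> - 0) at_top"
      by (intro tendsto_minus filterlim_compose[OF exp_at_bot])
    then show "((\<lambda>y. - exp (- \<mu> * y\<^sup>2)) \<longlongrightarrow> 0) at_top" by simp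
  qed (use \<mu> assms in auto)
  finally show ?thesis by (simp add: \<mu>_def)
qed

lemma prob_space_dist_measure:
  assumes "c > 0" "lb > 0"
  shows "prob_space (dist_measure c lb)"
proof
  have "emeasure (dist_measure c lb) {..0} = 0"
    unfolding dist_measure_def
    by (subst emeasure_density) (auto simp: dist_density_def nn_integral_0_iff_AE split: split_indicator)
  moreover have "emeasure (dist_measure c lb) UNIV = emeasure (dist_measure c lb) {..0} + emeasure (dist_measure c lb) {0<..}"
    by (subst plus_emeasure) (auto intro!: arg_cong[where f="emeasure _"])
  ultimately show "emeasure (dist_measure c lb) (space (dist_measure c lb)) = 1"
    using emeasure_dist_measure_greaterThan[OF assms, of 0] by simp
qed

text \<open>The minimum exceeds x iff both distances do, and independence multiplies the two tails;
  this doubles c to 2 c.\<close>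

lemma measure_min_greater:
  assumes "c > 0" "lb > 0" "x \<ge> 0"
  shows "measure (dist_measure c lb \<Otimes>\<^sub>M dist_measure c lb) {z. x < min (fst z) (snd z)} =
    exp (- (2 * c) * lb * pi * x\<^sup>2)"
proof -
  interpret prob_space "dist_measure c lb" using assms by (intro prob_space_dist_measure)
  have "{z. x < min (fst z) (snd z)} = {x<..} \<times> {x<..}" by auto
  then have "emeasure (dist_measure c lb \<Otimes>\<^sub>M dist_measure c lb) {z. x < min (fst z) (snd z)} =
      ennreal (exp (- c * lb * pi * x\<^sup>2)) * ennreal (exp (- c * lb * pi * x\<^sup>2))"
    by (simp add: emeasure_pair_measure_Times emeasure_dist_measure_greaterThan[OF assms] del: min_less_iff_conj)
  also have "\<dots> = ennreal (exp (- (2 * c) * lb * pi * x\<^sup>2))"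
    by (subst ennreal_mult'[symmetric]) (auto simp: mult_exp_exp)
  finally show ?thesis by (simp add: measure_def)
qed

text \<open>The truncation \<open>max 0\<close> is harmless, as distances are almost surely positive.\<close>

lemma distributed_min_square:
  assumes "c > 0" "lb > 0"
  shows "distributed (dist_measure c lb \<Otimes>\<^sub>M dist_measure c lb) lborel
    (\<lambda>z. (max 0 (min (fst z) (snd z)))\<^sup>2) (exponential_density (2 * c * lb * pi))"
proof -
  interpret D: prob_space "dist_measure c lb" using assms by (intro prob_space_dist_measure)
  interpret pair_prob_space "dist_measure c lb" "dist_measure c lb" ..
  let ?M = "dist_measure c lb \<Otimes>\<^sub>M dist_measure c lb"
  have [simp]: "space ?M = UNIV" by (simp add: space_pair_measure)
  have [measurable]: "(\<lambda>z. (max 0 (min (fst z) (snd z)))\<^sup>2) \<in> borel_measurable ?M" by measurable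
  have "measure ?M {z \<in> space ?M. (max 0 (min (fst z) (snd z)))\<^sup>2 \<le> b} = 1 - exp (- b * (2 * c * lb * pi))"
    if b: "b \<ge> 0" for b
  proof -
    \<comment> \<open>The truncation makes the equivalence hold for negative m too, where both sides
      are true.\<close>
    have eq: "((max 0 m)\<^sup>2 \<le> b) = (\<not> sqrt b < m)" for m :: real
    proof (cases "m \<ge> 0")
      case True
      then show ?thesis using b power_mono_iff[of m "sqrt b" 2] by (simp add: not_less)
    next
      case False
      then show ?thesis using b by (simp add: max_def not_less) (smt (verit) real_sqrt_ge_zero)
    qed
    have [measurable]: "{z. sqrt b < min (fst z) (snd z)} \<in> sets ?M"
    proof -
      have "{z \<in> space ?M. sqrt b < min (fst z) (snd z)} \<in> sets ?M" by measurable
      then show ?thesis by simp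
    qed
    have "{z \<in> space ?M. (max 0 (min (fst z) (snd z)))\<^sup>2 \<le> b} = space ?M - {z. sqrt b < min (fst z) (snd z)}"
      unfolding eq by auto
    then have "measure ?M {z \<in> space ?M. (max 0 (min (fst z) (snd z)))\<^sup>2 \<le> b} =
        1 - measure ?M {z. sqrt b < min (fst z) (snd z)}"
      by (simp only:) (rule prob_compl, measurable)
    also have "\<dots> = 1 - exp (- b * (2 * c * lb * pi))"
      using b by (subst measure_min_greater[OF assms]) (auto simp: mult_ac)
    finally show ?thesis .
  qed
  then show ?thesis
    using assms by (subst exponential_distributed_iff) auto
qed

section \<open>Reduction to one-dimensional integrals\<close>

lemma phi_eq_integral:
  assumes "c > 0" "lb > 0"
  shows "phi c alpha lb s2 P omega w = (\<integral>u. exponential_density (2 * c * lb * pi) u *\<^sub>R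
    exp (- (of_real (s2 / P) * w) * of_real (u powr (alpha / 2)) -
         of_real (pi * lb * omega) * w powr (2 / alpha) * of_real u) \<partial>lborel)"
proof -
  interpret D: prob_space "dist_measure c lb" using assms by (intro prob_space_dist_measure)
  interpret pair_prob_space "dist_measure c lb" "dist_measure c lb" ..
  let ?M = "dist_measure c lb \<Otimes>\<^sub>M dist_measure c lb"
  let ?D = "\<lambda>z::real\<times>real. (max 0 (min (fst z) (snd z)))\<^sup>2"
  define f where "f = (\<lambda>u. exp (- (of_real (s2 / P) * w) * of_real (u powr (alpha / 2)) -
         of_real (pi * lb * omega) * w powr (2 / alpha) * of_real u))"
  have [measurable]: "f \<in> borel_measurable borel" unfolding f_def by measurable
  \<comment> \<open>Where both distances are positive the truncation is void and d^\<alpha> =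
    (d^2)^(\<alpha>/2), so almost surely the integrand is a function of u = d^2 alone.\<close>
  have pos: "AE z in ?M. z \<in> {z. 0 < min (fst z) (snd z)}"
  proof (subst AE_in_set_eq_1)
    have "{z \<in> space ?M. 0 < min (fst z) (snd z)} \<in> sets ?M" by measurable
    then show "{z. 0 < min (fst z) (snd z)} \<in> events" by (simp add: space_pair_measure)
    show "prob {z. 0 < min (fst z) (snd z)} = 1"
      by (subst measure_min_greater[OF assms]) auto
  qed
  have "phi c alpha lb s2 P omega w = (\<integral>z. f (?D z) \<partial>?M)"
    unfolding phi_def
  proof (intro integral_cong_AE)
    show "AE z in ?M. (let d = min (fst z) (snd z) in
             exp (- complex_of_real (s2 / P) * w * complex_of_real (d powr alpha)
                  - complex_of_real (pi * lb * omega * d\<^sup>2) * w powr (2 / alpha))) = f (?D z)"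
      using pos
    proof eventually_elim
      case (elim z)
      define m where "m = min (fst z) (snd z)"
      have "m > 0" using elim by (simp add: m_def)
      then have "(m\<^sup>2) powr (alpha / 2) = m powr alpha"
        by (simp add: powr_powr flip: powr_numeral)
      then show ?case using \<open>m > 0\<close> by (simp add: f_def Let_def m_def[symmetric] mult_ac del: min_less_iff_conj)
    qed
  qed (unfold Let_def, measurable)
  also have "\<dots> = (\<integral>u. f u \<partial>distr ?M lborel ?D)"
    by (subst integral_distr) auto
  also have "distr ?M lborel ?D = density lborel (exponential_density (2 * c * lb * pi))"
    using distributed_min_square[OF assms] by (rule distributed_distr_eq_density)
  also have "(\<integral>u. f u \<partial>density lborel (exponential_density (2 * c * lb * pi))) =
     (\<integral>u. exponential_density (2 * c * lb * pi) u *\<^sub>R f u \<partial>lborel)"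
    using assms by (subst integral_density) (auto simp: exponential_density_nonneg)
  finally show ?thesis by (simp add: f_def)
qed

text \<open>The substitution u = exp s contributes the factor exp s, and the density dominates
  because the exponential has modulus at most 1 for u >= 0. Allowing Re W = 0 lets the same identity
  serve the vanishing-noise limit with W = 0.\<close>

lemma exponential_integral_exp_power:
  assumes l: "l > 0" and b: "Re b \<ge> 0" and W: "Re W \<ge> 0"
  shows "(\<integral>u. exponential_density l u *\<^sub>R exp (- W * of_real (u powr a) - b * of_real u) \<partial>lborel) =
    of_real l * (\<integral>s. exp (of_real s - (of_real l + b) * of_real (exp s) - W * of_real (exp (a * s))) \<partial>lborel)"
proof -
  define f where "f = (\<lambda>u. exponential_density l u *\<^sub>R exp (- W * of_real (u powr a) - b * of_real u))"
  have [measurable]: "f \<in> borel_measurable borel" unfolding f_def by measurable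
  have intf: "integrable lborel f"
  proof (rule Bochner_Integration.integrable_bound[OF integrable_exponential_density[OF l]])
    show "AE u in lborel. norm (f u) \<le> norm (exponential_density l u)"
    proof (intro AE_I2)
      fix u :: real
      show "norm (f u) \<le> norm (exponential_density l u)"
      proof (cases "u < 0")
        case False
        then have "Re (- W * of_real (u powr a) - b * of_real u) \<le> 0"
          using mult_nonneg_nonneg[OF b, of u] mult_nonneg_nonneg[OF W, of "u powr a"] by simp
        then show ?thesis by (simp add: f_def norm_exp_eq_Re mult_left_le)
      qed (simp add: f_def exponential_density_def)
    qed
  qed simp
  then have si: "set_integrable lborel {0<..} f"
    unfolding set_integrable_def by (intro integrable_mult_indicator) auto
  then have ab: "f absolutely_integrable_on {0<..}"
    unfolding set_integrable_def by (subst integrable_completion) auto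
  \<comment> \<open>The density is positive at u = 0, a point that u = exp s never reaches; it is
    removed as a null set.\<close>
  have "integral\<^sup>L lborel f = (LINT u:{0<..}|lborel. f u)"
    unfolding set_lebesgue_integral_def
  proof (rule integral_cong_AE)
    show "AE u in lborel. f u = indicat_real {0<..} u *\<^sub>R f u"
      using AE_lborel_singleton[of 0]
      by eventually_elim (auto simp: f_def exponential_density_def split: split_indicator)
  qed auto
  also have "\<dots> = integral {0<..} f" using set_borel_integral_eq_integral(2)[OF si] .
  also have "\<dots> = (\<integral>s. exp s *\<^sub>R f (exp s) \<partial>lborel)"
    using has_bochner_integral_exp_substitution[OF ab] by (simp add: has_bochner_integral_iff)
  also have "(\<lambda>s. exp s *\<^sub>R f (exp s)) =
      (\<lambda>s. of_real l * exp (of_real s - (of_real l + b) * of_real (exp s) - W * of_real (exp (a * s))))"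
    by (simp add: f_def fun_eq_iff exponential_density_def powr_def scaleR_conv_of_real mult_exp_exp
        algebra_simps flip: exp_of_real)
  finally show ?thesis by (simp add: f_def)
qed

text \<open>This supplies the limit value: W = 0 leaves the Gamma integral with exponent 1 and
  complex scale l + b.\<close>

lemma exponential_integral_exp:
  assumes l: "l > 0" and b: "Re b \<ge> 0"
  shows "(\<integral>u. exponential_density l u *\<^sub>R exp (- b * of_real u) \<partial>lborel) = of_real l / (of_real l + b)"
proof -
  have nz: "of_real l + b \<noteq> 0" using l b by (auto simp: complex_eq_iff)
  have "(\<integral>u. exponential_density l u *\<^sub>R exp (- b * of_real u) \<partial>lborel) =
      of_real l * (\<integral>s. exp (1 * of_real s - (of_real l + b) * of_real (exp s)) \<partial>lborel)"
    using exponential_integral_exp_power[OF l b, of 0 1] by simp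
  also have "\<dots> = of_real l * (Gamma 1 * (of_real l + b) powr (- 1))"
    using has_bochner_integral_Gamma_exp_complex[of 1 "of_real l + b"] l b
    by (simp add: has_bochner_integral_iff)
  finally show ?thesis using nz by (simp add: powr_minus divide_inverse)
qed

section \<open>The closed form and the vanishing-noise limit\<close>

theorem theorem3:
  fixes c alpha lb P s2 omega gamma :: real and w :: complex
  assumes "c = 5 / 4" and "alpha > 2" and "lb > 0" and "P > 0" and "s2 \<ge> 0" and "omega > 0"
    and "Re w > 0"
    and "0 < gamma" and "gamma < 2 / alpha"
  shows "(s2 > 0 \<longrightarrow>
           phi c alpha lb s2 P omega w =
             complex_of_real (2 * c) / (complex_of_real (2 * c) + omega * w powr (2 / alpha)) *
             foxH alpha gamma
               (complex_of_real (s2 / P) * w *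
                (complex_of_real (pi * lb) * (complex_of_real (2 * c) + omega * w powr (2 / alpha)))
                  powr (- complex_of_real (alpha / 2))))
         \<and> ((\<lambda>q. phi c alpha lb q P omega w) \<longlongrightarrow>
           complex_of_real (2 * c) / (complex_of_real (2 * c) + omega * w powr (2 / alpha)))
         (at_right 0)"
proof -
  have c: "c > 0" using assms by simp
  define l where "l = 2 * c * lb * pi"
  define b where "b = of_real (pi * lb * omega) * w powr (2 / alpha)"
  define A where "A = complex_of_real (pi * lb) * (complex_of_real (2 * c) + omega * w powr (2 / alpha))"
  have l: "l > 0" using c assms by (simp add: l_def)
  have "Re (w powr of_real (2 / alpha)) > 0" using assms by (intro Re_powr_of_real_pos) auto
  then have b: "Re b > 0" using assms by (simp add: b_def)
  have A: "A = of_real l + b" by (simp add: A_def l_def b_def algebra_simps)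
  have reA: "Re A > 0" using l b by (simp add: A)
  then have Anz: "A \<noteq> 0" by auto
  \<comment> \<open>The common factor \<open>pi * lb\<close> cancels: the prefactor is the real rate
    \<open>l\<close> over the complex rate \<open>A\<close>.\<close>
  have ratio: "of_real l / A = complex_of_real (2 * c) / (complex_of_real (2 * c) + omega * w powr (2 / alpha))"
    using assms by (simp add: A_def l_def)
  have phi: "phi c alpha lb q P omega w = (\<integral>u. exponential_density l u *\<^sub>R
      exp (- (of_real (q / P) * w) * of_real (u powr (alpha / 2)) - b * of_real u) \<partial>lborel)" for q
    using phi_eq_integral[OF c \<open>lb > 0\<close>, of alpha q P omega w] by (simp add: l_def b_def)
  have "phi c alpha lb s2 P omega w = of_real l / A *
      foxH alpha gamma (of_real (s2 / P) * w * A powr (- of_real (alpha / 2)))" if "s2 > 0"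
  proof -
    define W where "W = of_real (s2 / P) * w"
    have W: "Re W > 0" using that assms by (simp add: W_def)
    have "of_real (2 * pi) * foxH alpha gamma (W * A powr (- of_real (alpha / 2))) =
      (\<integral>t. Gamma (Complex gamma t) * Gamma (1 - of_real (alpha / 2) * Complex gamma t) *
         (W * A powr (- of_real (alpha / 2))) powr (- Complex gamma t) \<partial>lborel)"
      by (simp add: foxH_def Let_def)
    \<comment> \<open>Writing A^(a \<xi>) as A A^(a \<xi> - 1) with a = \<alpha> / 2 brings the
      integrand into Mellin-Barnes form; the extra factor A cancels against \<open>l / A\<close> at
      the end.\<close>
    also have "\<dots> = (\<integral>t. A * (Gamma (Complex gamma t) * Gamma (1 - of_real (alpha / 2) * Complex gamma t) *
         (W powr (- Complex gamma t) * A powr (of_real (alpha / 2) * Complex gamma t - 1))) \<partial>lborel)"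
    proof (intro Bochner_Integration.integral_cong refl)
      fix t
      \<comment> \<open>Here \<open>alpha > 2\<close> gives a >= 1, and the exponent 2 / \<alpha> is
        1 / a, as the sector argument requires.\<close>
      have "(W * A powr (- of_real (alpha / 2))) powr (- Complex gamma t) =
          W powr (- Complex gamma t) * A powr (of_real (alpha / 2) * Complex gamma t)"
        using powr_mult_powr_sector[of w "alpha / 2" "pi * lb" "2 * c" omega "s2 / P" "Complex gamma t"] c assms(2-) that
        by (simp add: W_def A_def)
      then show "Gamma (Complex gamma t) * Gamma (1 - of_real (alpha / 2) * Complex gamma t) *
         (W * A powr (- of_real (alpha / 2))) powr (- Complex gamma t) =
         A * (Gamma (Complex gamma t) * Gamma (1 - of_real (alpha / 2) * Complex gamma t) *
         (W powr (- Complex gamma t) * A powr (of_real (alpha / 2) * Complex gamma t - 1)))"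
        using Anz by (simp add: powr_diff)
    qed
    also have "\<dots> = A * (of_real (2 * pi) * (\<integral>s. exp (of_real s - A * of_real (exp s) - W * of_real (exp (alpha / 2 * s))) \<partial>lborel))"
      using assms reA W by (subst exp_power_integral_Mellin_Barnes[of gamma "alpha / 2"]) (auto simp: field_simps)
    finally have "foxH alpha gamma (W * A powr (- of_real (alpha / 2))) =
        A * (\<integral>s. exp (of_real s - A * of_real (exp s) - W * of_real (exp (alpha / 2 * s))) \<partial>lborel)"
      by simp
    moreover have "phi c alpha lb s2 P omega w =
        of_real l * (\<integral>s. exp (of_real s - A * of_real (exp s) - W * of_real (exp (alpha / 2 * s))) \<partial>lborel)"
      unfolding phi A W_def[symmetric] using l b W by (intro exponential_integral_exp_power) auto
    ultimately show ?thesis using Anz by (simp add: W_def)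
  qed
  moreover have "((\<lambda>q. phi c alpha lb q P omega w) \<longlongrightarrow> of_real l / A) (at_right 0)"
  \<comment> \<open>Passing to sequences makes dominated convergence available; positive noise
    values keep the modulus of the exponential at most 1, so the exponential density
    dominates.\<close>
  proof (rule tendsto_at_right_sequentially[of 0 1])
    fix S :: "nat \<Rightarrow> real"
    assume S: "\<And>n. 0 < S n" "S \<longlonglongrightarrow> 0"
    have "(\<lambda>n. phi c alpha lb (S n) P omega w) \<longlonglongrightarrow>
        (\<integral>u. exponential_density l u *\<^sub>R exp (- b * of_real u) \<partial>lborel)"
      unfolding phi
    proof (rule integral_dominated_convergence[OF _ _ integrable_exponential_density[OF l]])
      show "AE u in lborel. (\<lambda>n. exponential_density l u *\<^sub>R
          exp (- (of_real (S n / P) * w) * of_real (u powr (alpha / 2)) - b * of_real u)) \<longlonglongrightarrow>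
          exponential_density l u *\<^sub>R exp (- b * of_real u)"
      proof (intro AE_I2)
        fix u
        have "(\<lambda>n. exponential_density l u *\<^sub>R
          exp (- (of_real (S n / P) * w) * of_real (u powr (alpha / 2)) - b * of_real u)) \<longlonglongrightarrow>
          exponential_density l u *\<^sub>R exp (- (of_real (0 / P) * w) * of_real (u powr (alpha / 2)) - b * of_real u)"
          using S assms by (intro tendsto_intros) auto
        then show "(\<lambda>n. exponential_density l u *\<^sub>R
          exp (- (of_real (S n / P) * w) * of_real (u powr (alpha / 2)) - b * of_real u)) \<longlonglongrightarrow>
          exponential_density l u *\<^sub>R exp (- b * of_real u)" by simp
      qed
      show "AE u in lborel. norm (exponential_density l u *\<^sub>R
          exp (- (of_real (S n / P) * w) * of_real (u powr (alpha / 2)) - b * of_real u))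
          \<le> exponential_density l u" for n
      proof (intro AE_I2)
        fix u :: real
        have "0 \<le> S n / P * Re w * u powr (alpha / 2)" using S(1)[of n] assms by (simp add: less_imp_le)
        moreover have "0 \<le> Re b * u" if "\<not> u < 0" using b that by simp
        ultimately show "norm (exponential_density l u *\<^sub>R
          exp (- (of_real (S n / P) * w) * of_real (u powr (alpha / 2)) - b * of_real u))
          \<le> exponential_density l u"
          using l by (cases "u < 0") (auto simp: norm_exp_eq_Re exponential_density_def mult_left_le)
      qed
    qed auto
    then show "(\<lambda>n. phi c alpha lb (S n) P omega w) \<longlonglongrightarrow> of_real l / A"
      using exponential_integral_exp[OF l, of b] b by (simp add: A)
  qed simp
  ultimately show ?thesis unfolding ratio[symmetric] A_def[symmetric] by blast
qed

end
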